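(* Let $(X,d)$ be an infinite metric space and let $\mathfrak{B}$ be a bornology on $X$ with closed base, $X\notin\mathfrak{B}$. The following conditions are equivalent: (1) $X$ has the $\mathfrak{B}^s$-Hurewicz property. (2) ONE has no winning strategy in the $\mathfrak{B}^s$-Hurewicz game on $X$.
   Context: A bornology $\mathfrak{B}$ on $X$ is a family of subsets of $X$ that is closed under finite unions, hereditary (closed under taking subsets), and covers $X$. A base of $\mathfrak{B}$ is a subfamily of $\mathfrak{B}$ cofinal with respect to inclusion; it is closed if all its members are closed in $X$. For $B\in\mathfrak{B}$ and $\delta>0$, $B^\delta=\bigcup_{x\in B}\{y\in X: d(x,y)<\delta\}$. All open covers of $X$ are assumed to be countably infinite. An open $\mathfrak{B}^s$-cover of $X$ is an open cover $\mathcal{U}$ with $X\notin\mathcal{U}$ such that for each $B\in\mathfrak{B}$ there are $U\in\mathcal{U}$ and $\delta>0$ with $B^\delta\subseteq U$. $X$ has the $\mathfrak{B}^s$-Hurewicz property (strong $\mathfrak{B}$-Hurewicz property) if for each sequence $\{\mathcal{U}_n:n\in\mathbb{N}\}$ of open $\mathfrak{B}^s$-covers of $X$ there is a sequence $\{\mathcal{V}_n:n\in\mathbb{N}\}$, with $\mathcal{V}_n$ a finite subset of $\mathcal{U}_n$ for each $n$, such that for every $B\in\mathfrak{B}$ there exist $n_0\in\mathbb{N}$ and a sequence $\{\delta_n:n\ge n_0\}$ of positive reals such that for all $n\ge n_0$, $B^{\delta_n}\subseteq U$ for some $U\in\mathcal{V}_n$. The $\mathfrak{B}^s$-Hurewicz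 game on $X$: players ONE and TWO play infinitely many innings. In the $n$-th inning ONE selects an open $\mathfrak{B}^s$-cover $\mathcal{U}_n$ of $X$ and TWO responds with a finite set $\mathcal{V}_n\subseteq\mathcal{U}_n$. TWO wins the play $\mathcal{U}_1,\mathcal{V}_1,\mathcal{U}_2,\mathcal{V}_2,\dots$ if for each $B\in\mathfrak{B}$ there exist $n_0\in\mathbb{N}$ and a sequence $\{\delta_n:n\ge n_0\}$ of positive reals such that for all $n\ge n_0$, $B^{\delta_n}\subseteq U$ for some $U\in\mathcal{V}_n$; otherwise ONE wins. *)

theory Defs
  imports "HOL-Analysis.Analysis"
begin

text \<open>The metric space \<open>X\<close> is the universe of a type of class \<^class>\<open>metric_space\<close>; \<open>\<BB>\<close> is a family
  of subsets of it. Sequences and innings are indexed from 0.\<close>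

definition bornology :: "'a set set \<Rightarrow> bool" where
  "bornology \<BB> \<longleftrightarrow>
     (\<forall>\<F>. finite \<F> \<and> \<F> \<subseteq> \<BB> \<longrightarrow> \<Union>\<F> \<in> \<BB>) \<and>
     (\<forall>B\<in>\<BB>. \<forall>A. A \<subseteq> B \<longrightarrow> A \<in> \<BB>) \<and>
     \<Union>\<BB> = UNIV"

definition bornology_base :: "'a set set \<Rightarrow> 'a set set \<Rightarrow> bool" where
  "bornology_base \<BB>\<^sub>0 \<BB> \<longleftrightarrow> \<BB>\<^sub>0 \<subseteq> \<BB> \<and> (\<forall>B\<in>\<BB>. \<exists>C\<in>\<BB>\<^sub>0. B \<subseteq> C)"

definition has_closed_base :: "'a::topological_space set set \<Rightarrow> bool" where
  "has_closed_base \<BB> \<longleftrightarrow> (\<exists>\<BB>\<^sub>0. bornology_base \<BB>\<^sub>0 \<BB> \<and> (\<forall>C\<in>\<BB>\<^sub>0. closed C))"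

definition enlargement :: "'a::metric_space set \<Rightarrow> real \<Rightarrow> 'a set" where
  "enlargement B \<delta> = (\<Union>x\<in>B. {y. dist x y < \<delta>})"

text \<open>The standing convention that open covers are countably infinite is part of the definition.\<close>

definition open_Bs_cover :: "'a::metric_space set set \<Rightarrow> 'a set set \<Rightarrow> bool" where
  "open_Bs_cover \<BB> \<U> \<longleftrightarrow>
     countable \<U> \<and> infinite \<U> \<and>
     (\<forall>U\<in>\<U>. open U) \<and> \<Union>\<U> = UNIV \<and> UNIV \<notin> \<U> \<and>
     (\<forall>B\<in>\<BB>. \<exists>U\<in>\<U>. \<exists>\<delta>>0. enlargement B \<delta> \<subseteq> U)"

text \<open>The condition on \<open>(\<V>\<^sub>n)\<close> shared by the Hurewicz property and TWO's winning condition.\<close>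

definition eventually_Bs_covers :: "'a::metric_space set set \<Rightarrow> (nat \<Rightarrow> 'a set set) \<Rightarrow> bool" where
  "eventually_Bs_covers \<BB> \<V> \<longleftrightarrow>
     (\<forall>B\<in>\<BB>. \<exists>n\<^sub>0. \<exists>\<delta> :: nat \<Rightarrow> real.
        (\<forall>n\<ge>n\<^sub>0. \<delta> n > 0) \<and> (\<forall>n\<ge>n\<^sub>0. \<exists>U\<in>\<V> n. enlargement B (\<delta> n) \<subseteq> U))"

definition Bs_Hurewicz :: "'a::metric_space set set \<Rightarrow> bool" where
  "Bs_Hurewicz \<BB> \<longleftrightarrow>
     (\<forall>\<U>. (\<forall>n::nat. open_Bs_cover \<BB> (\<U> n)) \<longrightarrow>
        (\<exists>\<V>. (\<forall>n. finite (\<V> n) \<and> \<V> n \<subseteq> \<U> n) \<and> eventually_Bs_covers \<BB> \<V>))"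

text \<open>A strategy \<open>\<sigma>\<close> for ONE maps the list \<open>[\<V>\<^sub>0, \<dots>, \<V>\<^bsub>n-1\<^esub>]\<close> of TWO's moves so far to ONE's move in
  inning \<open>n\<close>; ONE's own earlier moves are determined by \<open>\<sigma>\<close>. Its values matter only at positions
  that can arise when ONE follows \<open>\<sigma>\<close> and TWO plays legally.\<close>

definition legal_history :: "('a set set list \<Rightarrow> 'a set set) \<Rightarrow> 'a set set list \<Rightarrow> bool" where
  "legal_history \<sigma> h \<longleftrightarrow> (\<forall>i<length h. finite (h ! i) \<and> h ! i \<subseteq> \<sigma> (take i h))"

definition ONE_strategy ::
  "'a::metric_space set set \<Rightarrow> ('a set set list \<Rightarrow> 'a set set) \<Rightarrow> bool" where
  "ONE_strategy \<BB> \<sigma> \<longleftrightarrow> (\<forall>h. legal_history \<sigma> h \<longrightarrow> open_Bs_cover \<BB> (\<sigma> h))"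

definition ONE_winning_strategy ::
  "'a::metric_space set set \<Rightarrow> ('a set set list \<Rightarrow> 'a set set) \<Rightarrow> bool" where
  "ONE_winning_strategy \<BB> \<sigma> \<longleftrightarrow>
     ONE_strategy \<BB> \<sigma> \<and>
     (\<forall>\<V>. (\<forall>n. finite (\<V> n) \<and> \<V> n \<subseteq> \<sigma> (map \<V> [0..<n])) \<longrightarrow> \<not> eventually_Bs_covers \<BB> \<V>)"

end

theory Submission
  imports Defs
begin

text \<open>If the Hurewicz property fails for a sequence of covers, ONE wins by playing that sequence,
  whatever TWO does. For the converse, the point is that ONE's covers are countable, so that TWO has
  only countably many replies at each position, and a strategy of ONE has only countably many
  positions altogether. The Hurewicz property applies to all the covers in this tree of positions at
  once: it selects a finite subset \<open>F h\<close> of the cover \<open>\<sigma> h\<close> at every position \<open>h\<close>, such that each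
  \<open>B\<close> in the bornology is missed, that is, has no enlargement inside a member of \<open>F h\<close>, at finitely
  many positions only (\<open>Bs_Hurewicz_countable_index\<close>). TWO then answers
  \<open>F h\<close> at position \<open>h\<close>. The play so obtained runs through pairwise different positions, hence each
  \<open>B\<close> is missed in finitely many innings only, and TWO wins.\<close>

definition strongly_inside :: "'a::metric_space set \<Rightarrow> 'a set set \<Rightarrow> bool" where
  "strongly_inside B \<V> \<longleftrightarrow> (\<exists>U\<in>\<V>. \<exists>\<delta>>0. enlargement B \<delta> \<subseteq> U)"

text \<open>Choosing a radius for each inning absorbs the sequence of radii into a pointwise condition.
  Counting exceptions does not refer to the order of the innings, which allows passing to other
  countable index sets.\<close>

lemma eventually_Bs_covers_iff_finite_exceptions:
  "eventually_Bs_covers \<BB> \<V> \<longleftrightarrow> (\<forall>B\<in>\<BB>. finite {n. \<not> strongly_inside B (\<V> n)})"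
proof -
  have "(\<exists>n\<^sub>0. \<exists>\<delta> :: nat \<Rightarrow> real.
          (\<forall>n\<ge>n\<^sub>0. \<delta> n > 0) \<and> (\<forall>n\<ge>n\<^sub>0. \<exists>U\<in>\<V> n. enlargement B (\<delta> n) \<subseteq> U)) \<longleftrightarrow>
        eventually (\<lambda>n. strongly_inside B (\<V> n)) sequentially" (is "?L \<longleftrightarrow> ?R") for B
  proof
    assume ?L
    then obtain n\<^sub>0 and \<delta> :: "nat \<Rightarrow> real"
      where \<delta>: "\<forall>n\<ge>n\<^sub>0. \<delta> n > 0" "\<forall>n\<ge>n\<^sub>0. \<exists>U\<in>\<V> n. enlargement B (\<delta> n) \<subseteq> U"
      by (elim exE conjE)
    have "strongly_inside B (\<V> n)" if n: "n \<ge> n\<^sub>0" for n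
    proof -
      obtain U where "U \<in> \<V> n" "enlargement B (\<delta> n) \<subseteq> U"
        using \<delta>(2)[rule_format, OF n] by (elim bexE)
      then show ?thesis
        unfolding strongly_inside_def
        by (intro bexI[of _ U] exI[of _ "\<delta> n"] conjI \<delta>(1)[rule_format, OF n])
    qed
    then show ?R
      unfolding eventually_sequentially by (intro exI[of _ n\<^sub>0] allI impI)
  next
    assume ?R
    then obtain n\<^sub>0 where n\<^sub>0: "\<forall>n\<ge>n\<^sub>0. strongly_inside B (\<V> n)"
      unfolding eventually_sequentially by (elim exE)
    have "\<exists>\<delta>. n \<ge> n\<^sub>0 \<longrightarrow> \<delta> > 0 \<and> (\<exists>U\<in>\<V> n. enlargement B \<delta> \<subseteq> U)" for n
    proof (cases "n \<ge> n\<^sub>0")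
      case True
      obtain U \<delta> where "U \<in> \<V> n" "\<delta> > 0" "enlargement B \<delta> \<subseteq> U"
        using n\<^sub>0[rule_format, OF True] unfolding strongly_inside_def by (elim bexE exE conjE)
      then show ?thesis
        by (intro exI[of _ \<delta>] impI conjI bexI[of _ U])
    qed simp
    then obtain \<delta> where \<delta>: "\<forall>n. n \<ge> n\<^sub>0 \<longrightarrow> \<delta> n > 0 \<and> (\<exists>U\<in>\<V> n. enlargement B (\<delta> n) \<subseteq> U)"
      using choice by (metis (no_types, lifting))
    show ?L
      by (intro exI[of _ n\<^sub>0] exI[of _ \<delta>]) (simp add: \<delta>)
  qed
  then show ?thesis
    unfolding eventually_Bs_covers_def
    by (simp only: eventually_cofinite[symmetric] cofinite_eq_sequentially)
qed

text \<open>\<open>Eventually\<close> along an enumeration of \<open>I\<close> means \<open>up to finitely many indices\<close>, so the selection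
  for one enumeration serves along every injective sequence in \<open>I\<close>. This matters because the order
  in which a play meets the positions depends on the selection itself.\<close>

lemma Bs_Hurewicz_countable_index:
  assumes "Bs_Hurewicz \<BB>" and "countable I" "infinite I"
    and covers: "\<And>i. i \<in> I \<Longrightarrow> open_Bs_cover \<BB> (\<U> i)"
  shows "\<exists>F. (\<forall>i\<in>I. finite (F i) \<and> F i \<subseteq> \<U> i) \<and>
    (\<forall>B\<in>\<BB>. finite {i\<in>I. \<not> strongly_inside B (F i)})"
proof -
  let ?e = "from_nat_into I" and ?c = "to_nat_on I"
  have e: "?e n \<in> I" for n
    using \<open>infinite I\<close> by (metis finite.emptyI from_nat_into)
  have ec: "?e (?c i) = i" if "i \<in> I" for i
    using that \<open>countable I\<close> by simp
  obtain \<V> where \<V>: "\<And>n. finite (\<V> n) \<and> \<V> n \<subseteq> \<U> (?e n)"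
    and ev: "eventually_Bs_covers \<BB> \<V>"
    using \<open>Bs_Hurewicz \<BB>\<close>[unfolded Bs_Hurewicz_def, rule_format, of "\<lambda>n. \<U> (?e n)"] e covers
    by blast
  show ?thesis
  proof (intro exI[of _ "\<lambda>i. \<V> (?c i)"] conjI ballI)
    fix i assume "i \<in> I"
    then show "finite (\<V> (?c i))" and "\<V> (?c i) \<subseteq> \<U> i"
      using \<V>[of "?c i"] ec by simp_all
  next
    fix B assume "B \<in> \<BB>"
    then have "finite (?e ` {n. \<not> strongly_inside B (\<V> n)})"
      using ev by (simp add: eventually_Bs_covers_iff_finite_exceptions)
    moreover have "{i\<in>I. \<not> strongly_inside B (\<V> (?c i))} \<subseteq> ?e ` {n. \<not> strongly_inside B (\<V> n)}"
      using ec by force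
    ultimately show "finite {i\<in>I. \<not> strongly_inside B (\<V> (?c i))}"
      by (rule rev_finite_subset)
  qed
qed

lemma legal_history_snoc:
  "legal_history \<sigma> (h @ [\<W>]) \<longleftrightarrow> legal_history \<sigma> h \<and> finite \<W> \<and> \<W> \<subseteq> \<sigma> h"
  by (auto simp: legal_history_def nth_append less_Suc_eq)

text \<open>A countable set has only countably many finite subsets, so the tree of positions is countably
  branching.\<close>

lemma countable_legal_histories:
  assumes "ONE_strategy \<BB> \<sigma>"
  shows "countable {h. legal_history \<sigma> h}"
proof -
  have "countable {h. legal_history \<sigma> h \<and> length h = n}" (is "countable (?L n)") for n
  proof (induction n)
    case 0
    have "?L 0 \<subseteq> {[]}" by auto
    then show ?case by (rule countable_subset) simp
  next
    case (Suc n)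
    have "?L (Suc n) \<subseteq> (\<Union>h\<in>?L n. (\<lambda>\<W>. h @ [\<W>]) ` {\<W>. finite \<W> \<and> \<W> \<subseteq> \<sigma> h})"
    proof
      fix g assume g: "g \<in> ?L (Suc n)"
      then obtain h \<W> where "g = h @ [\<W>]"
        by (cases g rule: rev_cases) auto
      with g show "g \<in> (\<Union>h\<in>?L n. (\<lambda>\<W>. h @ [\<W>]) ` {\<W>. finite \<W> \<and> \<W> \<subseteq> \<sigma> h})"
        by (auto simp: legal_history_snoc)
    qed
    moreover have "countable (\<sigma> h)" if "h \<in> ?L n" for h
      using assms that by (auto simp: ONE_strategy_def open_Bs_cover_def)
    then have "countable (\<Union>h\<in>?L n. (\<lambda>\<W>. h @ [\<W>]) ` {\<W>. finite \<W> \<and> \<W> \<subseteq> \<sigma> h})"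
      by (intro countable_UN Suc.IH countable_image countable_Collect_finite_subset)
    ultimately show ?case by (rule countable_subset)
  qed
  then have "countable (\<Union>n. ?L n)" by blast
  moreover have "{h. legal_history \<sigma> h} = (\<Union>n. ?L n)" by auto
  ultimately show ?thesis by simp
qed

lemma infinite_legal_histories: "infinite {h. legal_history \<sigma> h}"
proof
  assume "finite {h. legal_history \<sigma> h}"
  \<comment> \<open>Passing in every inning is legal, so there are positions of every length.\<close>
  moreover have "range (\<lambda>n. replicate n {}) \<subseteq> {h. legal_history \<sigma> h}"
    by (auto simp: legal_history_def)
  ultimately have "finite (range (\<lambda>n. replicate n ({} :: 'a set set)))"
    by (rule rev_finite_subset)
  moreover have "inj (\<lambda>n. replicate n ({} :: 'a set set))"
    by (rule injI) (metis length_replicate)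
  ultimately show False
    using finite_imageD infinite_UNIV_nat by blast
qed

text \<open>The course-of-values recursion for \<open>\<V>\<close> becomes a simple one for the position \<open>h n\<close> before
  inning \<open>n\<close>.\<close>

lemma play_from_positional_replies:
  "\<exists>\<V>. \<forall>n. \<V> n = F (map \<V> [0..<n])"
proof -
  define h where "h = rec_nat [] (\<lambda>_ g. g @ [F g])"
  have "map (\<lambda>n. F (h n)) [0..<n] = h n" for n
    by (induction n) (simp_all add: h_def)
  then show ?thesis
    by (intro exI[of _ "\<lambda>n. F (h n)"]) simp
qed

lemma Bs_Hurewicz_imp_no_winning_strategy:
  assumes "Bs_Hurewicz \<BB>"
  shows "\<not> ONE_winning_strategy \<BB> \<sigma>"
proof
  assume win: "ONE_winning_strategy \<BB> \<sigma>"
  then have strat: "ONE_strategy \<BB> \<sigma>"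
    by (simp add: ONE_winning_strategy_def)
  let ?L = "{h. legal_history \<sigma> h}"
  have covers: "open_Bs_cover \<BB> (\<sigma> h)" if "h \<in> ?L" for h
    using strat that by (simp add: ONE_strategy_def)
  have "\<exists>F. (\<forall>h\<in>?L. finite (F h) \<and> F h \<subseteq> \<sigma> h) \<and>
      (\<forall>B\<in>\<BB>. finite {h\<in>?L. \<not> strongly_inside B (F h)})"
    by (rule Bs_Hurewicz_countable_index
        [OF assms countable_legal_histories[OF strat] infinite_legal_histories]) (rule covers)
  then obtain F where F: "\<forall>h\<in>?L. finite (F h) \<and> F h \<subseteq> \<sigma> h"
    and cofinite: "\<forall>B\<in>\<BB>. finite {h\<in>?L. \<not> strongly_inside B (F h)}"
    by (elim exE conjE)
  obtain \<V> where "\<forall>n. \<V> n = F (map \<V> [0..<n])"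
    by (rule exE[OF play_from_positional_replies[of F]])
  then have \<V>: "\<V> n = F (map \<V> [0..<n])" for n
    by (rule spec)
  let ?p = "\<lambda>n. map \<V> [0..<n]"
  have legal: "?p n \<in> ?L" for n
  proof (induction n)
    case 0
    show ?case by (simp add: legal_history_def)
  next
    case (Suc n)
    then show ?case
      using bspec[OF F Suc] \<V>[of n] by (simp add: legal_history_snoc)
  qed
  have "eventually_Bs_covers \<BB> \<V>"
    unfolding eventually_Bs_covers_iff_finite_exceptions
  proof
    fix B assume "B \<in> \<BB>"
    \<comment> \<open>Positions of different innings have different lengths.\<close>
    have "inj ?p"
      by (rule injI) (metis diff_zero length_map length_upt)
    then have "finite (?p -` {h\<in>?L. \<not> strongly_inside B (F h)})"
      using bspec[OF cofinite \<open>B \<in> \<BB>\<close>] by (rule finite_vimageI[rotated])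
    moreover have "{n. \<not> strongly_inside B (\<V> n)} \<subseteq> ?p -` {h\<in>?L. \<not> strongly_inside B (F h)}"
    proof
      fix n assume "n \<in> {n. \<not> strongly_inside B (\<V> n)}"
      then have "\<not> strongly_inside B (F (?p n))"
        by (subst (asm) \<V>) simp
      then show "n \<in> ?p -` {h\<in>?L. \<not> strongly_inside B (F h)}"
        using legal by blast
    qed
    ultimately show "finite {n. \<not> strongly_inside B (\<V> n)}"
      by (rule rev_finite_subset)
  qed
  moreover have "finite (\<V> n) \<and> \<V> n \<subseteq> \<sigma> (?p n)" for n
    using bspec[OF F legal[of n]] \<V>[of n] by simp
  ultimately show False
    using win unfolding ONE_winning_strategy_def by blast
qed

lemma not_Bs_Hurewicz_imp_winning_strategy:
  assumes "\<not> Bs_Hurewicz \<BB>"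
  shows "\<exists>\<sigma>. ONE_winning_strategy \<BB> \<sigma>"
proof -
  from assms obtain \<U> where \<U>: "\<And>n::nat. open_Bs_cover \<BB> (\<U> n)"
    and fail: "\<And>\<V>. (\<forall>n. finite (\<V> n) \<and> \<V> n \<subseteq> \<U> n) \<Longrightarrow> \<not> eventually_Bs_covers \<BB> \<V>"
    unfolding Bs_Hurewicz_def by blast
  have "ONE_winning_strategy \<BB> (\<lambda>h. \<U> (length h))"
    using \<U> fail by (simp add: ONE_winning_strategy_def ONE_strategy_def)
  then show ?thesis by blast
qed

theorem theorem4p1:
  fixes \<BB> :: "'a::metric_space set set"
  assumes "infinite (UNIV :: 'a set)"
    and "bornology \<BB>"
    and "has_closed_base \<BB>"
    and "UNIV \<notin> \<BB>"
  shows "Bs_Hurewicz \<BB> \<longleftrightarrow> \<not> (\<exists>\<sigma>. ONE_winning_strategy \<BB> \<sigma>)"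
  using Bs_Hurewicz_imp_no_winning_strategy not_Bs_Hurewicz_imp_winning_strategy by blast

end
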